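(* Let $\mathcal{C}$ be a distributive category (a category with finite products and finite coproducts in which, for all objects $A,B,C$, the canonical morphism $A\times B + A\times C\to A\times (B+C)$ is an isomorphism), and let $S$ be an object of $\mathcal{C}$ (the object of states). Consider the language for states whose pure terms $A\to B$ are the morphisms $A\to B$ of $\mathcal{C}$ and whose general terms (modifiers) $A\to B$ are the morphisms $A\times S\to B\times S$ of $\mathcal{C}$, as described in the context. Then this language is compatible with conditionals, and it is compatible with sequential pairs with respect to the weak equality $\sim$. Explicitly: (1) (Conditionals) for all modifiers $f_1\colon A_1\to B$ and $f_2\colon A_2\to B$ (i.e. morphisms $f_1\colon A_1\times S\to B\times S$, $f_2\colon A_2\times S\to B\times S$ in $\mathcal{C}$) there exists a unique modifier $h\colon A_1+A_2\to B$ (a morphism $h\colon (A_1+A_2)\times S\to B\times S$) with $h\circ(\mathrm{copr}_1\times \mathrm{id}_S)=f_1$ and $h\circ(\mathrm{copr}_2\times\mathrm{id}_S)=f_2$; (2) (Sequential pairs) for every pure term $f_1\colon A\to B_1$ and every modifier $f_2\colon A\to B_2$ there exists a unique modifier $\langle f_1,f_2\rangle_l\colon A\to B_1\times B_2$ such that $\mathrm{pr}_1\circ\langle f_1,f_2\rangle_l\sim f_1$ and $\mathrm{pr}_2\circ\langle f_1,f_2\rangle_l= f_2$ (composition and equalities taken in the category of modifiers), and symmetrically for every modifier $f_1\colon A\to B_1$ and pure term $f_2\colon A\to B_2$ there exists a unique modifier $\langle f_1,f_2\rangle_r\colon A\to B_1\times B_2$ with $\mathrm{pr}_1\circ\langle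 f_1,f_2\rangle_r= f_1$ and $\mathrm{pr}_2\circ\langle f_1,f_2\rangle_r\sim f_2$.
   Context: The comonad of states on $\mathcal{C}$ has endofunctor $X\mapsto X\times S$, counit $\varepsilon_X\colon X\times S\to X$ the projection. Terms of the language for states are interpreted as follows: a pure term $f\colon A\to B$ is a morphism $f\colon A\to B$ of $\mathcal{C}$; a modifier (general term) $h\colon A\to B$ is a morphism $h\colon A\times S\to B\times S$ of $\mathcal{C}$; modifiers compose as morphisms of $\mathcal{C}$, and a pure term $f$ is regarded as the modifier $f\times\mathrm{id}_S$. In particular the structural morphisms (projections $\mathrm{pr}_i\colon B_1\times B_2\to B_i$, coprojections $\mathrm{copr}_i\colon A_i\to A_1+A_2$) are pure. A (strong) equation $f=g$ between modifiers $A\to B$ means equality of the morphisms $A\times S\to B\times S$; a weak equation $f\sim g$ between modifiers $A\to B$ means $\varepsilon_B\circ f=\varepsilon_B\circ g\colon A\times S\to B$. A language with effects (pure terms forming a category $\mathcal{C}$ with finite products and coproducts, general terms forming a larger category with the same objects) is compatible with conditionals if copairs of general terms exist uniquely as in (1), and compatible with sequential pairs with respect to a relation $\gg$ between pure and general terms (equal to equality on pure terms) if left and right pairs of a pure term and a general term exist uniquely as in (2), with $\sim$ here playing the role of $\gg$. *)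

theory Defs
  imports Main
begin

section \<open>Categories with chosen finite products and coproducts\<close>

text \<open>
  Composition is an untyped operation that is only constrained on composable pairs.
  Hom-sets are not required to be disjoint, so a morphism may have several types. Categories given
  by domain and codomain maps are the special case where the hom-sets are disjoint. The
  generality is needed for the category of modifiers, where \<open>A \<times> S = A' \<times> S\<close> may hold
  for distinct objects \<open>A\<close> and \<open>A'\<close>.
\<close>

record ('o, 'm) cat_data =
  Obj :: "'o set"
  Hom :: "'o \<Rightarrow> 'o \<Rightarrow> 'm set"
  Comp :: "'m \<Rightarrow> 'm \<Rightarrow> 'm"  (infixr "\<cdot>\<index>" 75)
  Id :: "'o \<Rightarrow> 'm"

locale category =
  fixes C :: "('o, 'm, 'x) cat_data_scheme" (structure)
  assumes Id_in_Hom: "A \<in> Obj C \<Longrightarrow> Id C A \<in> Hom C A A"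
    and Comp_in_Hom:
      "\<lbrakk>A \<in> Obj C; B \<in> Obj C; D \<in> Obj C; f \<in> Hom C A B; g \<in> Hom C B D\<rbrakk>
        \<Longrightarrow> g \<cdot> f \<in> Hom C A D"
    and Comp_assoc:
      "\<lbrakk>A \<in> Obj C; B \<in> Obj C; D \<in> Obj C; E \<in> Obj C;
        f \<in> Hom C A B; g \<in> Hom C B D; h \<in> Hom C D E\<rbrakk>
        \<Longrightarrow> (h \<cdot> g) \<cdot> f = h \<cdot> (g \<cdot> f)"
    and Comp_Id_right: "\<lbrakk>A \<in> Obj C; B \<in> Obj C; f \<in> Hom C A B\<rbrakk> \<Longrightarrow> f \<cdot> Id C A = f"
    and Comp_Id_left: "\<lbrakk>A \<in> Obj C; B \<in> Obj C; f \<in> Hom C A B\<rbrakk> \<Longrightarrow> Id C B \<cdot> f = f"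

definition is_iso :: "('o, 'm, 'x) cat_data_scheme \<Rightarrow> 'o \<Rightarrow> 'o \<Rightarrow> 'm \<Rightarrow> bool" where
  "is_iso C A B f \<longleftrightarrow> f \<in> Hom C A B \<and>
    (\<exists>g \<in> Hom C B A. g \<cdot>\<^bsub>C\<^esub> f = Id C A \<and> f \<cdot>\<^bsub>C\<^esub> g = Id C B)"

record ('o, 'm) bicart_data = "('o, 'm) cat_data" +
  Prod :: "'o \<Rightarrow> 'o \<Rightarrow> 'o"  (infixr "\<otimes>\<index>" 80)
  pr1 :: "'o \<Rightarrow> 'o \<Rightarrow> 'm"
  pr2 :: "'o \<Rightarrow> 'o \<Rightarrow> 'm"
  Sum :: "'o \<Rightarrow> 'o \<Rightarrow> 'o"  (infixr "\<oplus>\<index>" 78)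
  copr1 :: "'o \<Rightarrow> 'o \<Rightarrow> 'm"
  copr2 :: "'o \<Rightarrow> 'o \<Rightarrow> 'm"

locale bicartesian_category = category C
  for C :: "('o, 'm, 'x) bicart_data_scheme" (structure) +
  assumes terminal: "\<exists>T \<in> Obj C. \<forall>A \<in> Obj C. \<exists>!t. t \<in> Hom C A T"
    and Prod_Obj: "\<lbrakk>A \<in> Obj C; B \<in> Obj C\<rbrakk> \<Longrightarrow> A \<otimes> B \<in> Obj C"
    and pr1_in_Hom: "\<lbrakk>A \<in> Obj C; B \<in> Obj C\<rbrakk> \<Longrightarrow> pr1 C A B \<in> Hom C (A \<otimes> B) A"
    and pr2_in_Hom: "\<lbrakk>A \<in> Obj C; B \<in> Obj C\<rbrakk> \<Longrightarrow> pr2 C A B \<in> Hom C (A \<otimes> B) B"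
    and Prod_universal:
      "\<lbrakk>A \<in> Obj C; B \<in> Obj C; X \<in> Obj C; f \<in> Hom C X A; g \<in> Hom C X B\<rbrakk>
        \<Longrightarrow> \<exists>!h. h \<in> Hom C X (A \<otimes> B) \<and> pr1 C A B \<cdot> h = f \<and> pr2 C A B \<cdot> h = g"
    and initial: "\<exists>Z \<in> Obj C. \<forall>A \<in> Obj C. \<exists>!t. t \<in> Hom C Z A"
    and Sum_Obj: "\<lbrakk>A \<in> Obj C; B \<in> Obj C\<rbrakk> \<Longrightarrow> A \<oplus> B \<in> Obj C"
    and copr1_in_Hom: "\<lbrakk>A \<in> Obj C; B \<in> Obj C\<rbrakk> \<Longrightarrow> copr1 C A B \<in> Hom C A (A \<oplus> B)"
    and copr2_in_Hom: "\<lbrakk>A \<in> Obj C; B \<in> Obj C\<rbrakk> \<Longrightarrow> copr2 C A B \<in> Hom C B (A \<oplus> B)"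
    and Sum_universal:
      "\<lbrakk>A \<in> Obj C; B \<in> Obj C; X \<in> Obj C; f \<in> Hom C A X; g \<in> Hom C B X\<rbrakk>
        \<Longrightarrow> \<exists>!h. h \<in> Hom C (A \<oplus> B) X \<and> h \<cdot> copr1 C A B = f \<and> h \<cdot> copr2 C A B = g"

definition pair :: "('o, 'm, 'x) bicart_data_scheme \<Rightarrow> 'o \<Rightarrow> 'o \<Rightarrow> 'o \<Rightarrow> 'm \<Rightarrow> 'm \<Rightarrow> 'm" where
  "pair C X A B f g = (THE h. h \<in> Hom C X (A \<otimes>\<^bsub>C\<^esub> B) \<and>
    pr1 C A B \<cdot>\<^bsub>C\<^esub> h = f \<and> pr2 C A B \<cdot>\<^bsub>C\<^esub> h = g)"

definition copair :: "('o, 'm, 'x) bicart_data_scheme \<Rightarrow> 'o \<Rightarrow> 'o \<Rightarrow> 'o \<Rightarrow> 'm \<Rightarrow> 'm \<Rightarrow> 'm" where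
  "copair C A B X f g = (THE h. h \<in> Hom C (A \<oplus>\<^bsub>C\<^esub> B) X \<and>
    h \<cdot>\<^bsub>C\<^esub> copr1 C A B = f \<and> h \<cdot>\<^bsub>C\<^esub> copr2 C A B = g)"

text \<open>\<open>prod_map C A A' B B' f g\<close> is \<open>f \<times> g\<close> for \<open>f : A \<rightarrow> B\<close> and \<open>g : A' \<rightarrow> B'\<close>.\<close>

definition prod_map ::
    "('o, 'm, 'x) bicart_data_scheme \<Rightarrow> 'o \<Rightarrow> 'o \<Rightarrow> 'o \<Rightarrow> 'o \<Rightarrow> 'm \<Rightarrow> 'm \<Rightarrow> 'm" where
  "prod_map C A A' B B' f g =
    pair C (A \<otimes>\<^bsub>C\<^esub> A') B B' (f \<cdot>\<^bsub>C\<^esub> pr1 C A A') (g \<cdot>\<^bsub>C\<^esub> pr2 C A A')"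

definition distributor :: "('o, 'm, 'x) bicart_data_scheme \<Rightarrow> 'o \<Rightarrow> 'o \<Rightarrow> 'o \<Rightarrow> 'm" where
  "distributor C A B D =
    copair C (A \<otimes>\<^bsub>C\<^esub> B) (A \<otimes>\<^bsub>C\<^esub> D) (A \<otimes>\<^bsub>C\<^esub> (B \<oplus>\<^bsub>C\<^esub> D))
      (prod_map C A B A (B \<oplus>\<^bsub>C\<^esub> D) (Id C A) (copr1 C B D))
      (prod_map C A D A (B \<oplus>\<^bsub>C\<^esub> D) (Id C A) (copr2 C B D))"

locale distributive_category = bicartesian_category C
  for C :: "('o, 'm, 'x) bicart_data_scheme" (structure) +
  assumes distributive:
    "\<lbrakk>A \<in> Obj C; B \<in> Obj C; D \<in> Obj C\<rbrakk>
      \<Longrightarrow> is_iso C ((A \<otimes> B) \<oplus> (A \<otimes> D)) (A \<otimes> (B \<oplus> D)) (distributor C A B D)"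


section \<open>Languages with effects\<close>

text \<open>
  \<open>embed L A B f\<close> is the pure term \<open>f : A \<rightarrow> B\<close> regarded as a general term. It need not be
  injective: for states, \<open>f \<mapsto> f \<times> id\<close> fails to be injective when for instance the object of
  states is initial.
\<close>

record ('o, 'p, 'm) effect_language =
  pure :: "('o, 'p) bicart_data"
  general :: "('o, 'm) cat_data"
  embed :: "'o \<Rightarrow> 'o \<Rightarrow> 'p \<Rightarrow> 'm"

locale language_with_effects =
  fixes L :: "('o, 'p, 'm) effect_language"
  assumes pure_bicartesian: "bicartesian_category (pure L)"
    and general_category: "category (general L)"
    and same_Obj: "Obj (general L) = Obj (pure L)"
    and embed_in_Hom:
      "\<lbrakk>A \<in> Obj (pure L); B \<in> Obj (pure L); f \<in> Hom (pure L) A B\<rbrakk>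
        \<Longrightarrow> embed L A B f \<in> Hom (general L) A B"
    and embed_Id: "A \<in> Obj (pure L) \<Longrightarrow> embed L A A (Id (pure L) A) = Id (general L) A"
    and embed_Comp:
      "\<lbrakk>A \<in> Obj (pure L); B \<in> Obj (pure L); D \<in> Obj (pure L);
        f \<in> Hom (pure L) A B; g \<in> Hom (pure L) B D\<rbrakk>
        \<Longrightarrow> embed L A D (g \<cdot>\<^bsub>pure L\<^esub> f) = embed L B D g \<cdot>\<^bsub>general L\<^esub> embed L A B f"

definition compatible_with_conditionals :: "('o, 'p, 'm) effect_language \<Rightarrow> bool" where
  "compatible_with_conditionals L \<longleftrightarrow> language_with_effects L \<and>
    (let C = pure L; K = general L in
      \<forall>A1 \<in> Obj C. \<forall>A2 \<in> Obj C. \<forall>B \<in> Obj C. \<forall>f1 \<in> Hom K A1 B. \<forall>f2 \<in> Hom K A2 B.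
        \<exists>!h. h \<in> Hom K (A1 \<oplus>\<^bsub>C\<^esub> A2) B \<and>
          h \<cdot>\<^bsub>K\<^esub> embed L A1 (A1 \<oplus>\<^bsub>C\<^esub> A2) (copr1 C A1 A2) = f1 \<and>
          h \<cdot>\<^bsub>K\<^esub> embed L A2 (A1 \<oplus>\<^bsub>C\<^esub> A2) (copr2 C A1 A2) = f2)"

text \<open>
  The relation \<open>R A B\<close> relates general terms \<open>A \<rightarrow> B\<close>; pure terms enter it through \<open>embed\<close>. That it
  is equality on pure terms refers to equality of pure terms regarded as general terms.
\<close>

definition compatible_with_sequential_pairs ::
    "('o, 'p, 'm) effect_language \<Rightarrow> ('o \<Rightarrow> 'o \<Rightarrow> 'm \<Rightarrow> 'm \<Rightarrow> bool) \<Rightarrow> bool" where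
  "compatible_with_sequential_pairs L R \<longleftrightarrow> language_with_effects L \<and>
    (let C = pure L; K = general L in
      (\<forall>A \<in> Obj C. \<forall>B \<in> Obj C. \<forall>f \<in> Hom C A B. \<forall>g \<in> Hom C A B.
        R A B (embed L A B f) (embed L A B g) \<longleftrightarrow> embed L A B f = embed L A B g) \<and>
      (\<forall>A \<in> Obj C. \<forall>B1 \<in> Obj C. \<forall>B2 \<in> Obj C. \<forall>f1 \<in> Hom C A B1. \<forall>f2 \<in> Hom K A B2.
        \<exists>!h. h \<in> Hom K A (B1 \<otimes>\<^bsub>C\<^esub> B2) \<and>
          R A B1 (embed L (B1 \<otimes>\<^bsub>C\<^esub> B2) B1 (pr1 C B1 B2) \<cdot>\<^bsub>K\<^esub> h) (embed L A B1 f1) \<and>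
          embed L (B1 \<otimes>\<^bsub>C\<^esub> B2) B2 (pr2 C B1 B2) \<cdot>\<^bsub>K\<^esub> h = f2) \<and>
      (\<forall>A \<in> Obj C. \<forall>B1 \<in> Obj C. \<forall>B2 \<in> Obj C. \<forall>f1 \<in> Hom K A B1. \<forall>f2 \<in> Hom C A B2.
        \<exists>!h. h \<in> Hom K A (B1 \<otimes>\<^bsub>C\<^esub> B2) \<and>
          embed L (B1 \<otimes>\<^bsub>C\<^esub> B2) B1 (pr1 C B1 B2) \<cdot>\<^bsub>K\<^esub> h = f1 \<and>
          R A B2 (embed L (B1 \<otimes>\<^bsub>C\<^esub> B2) B2 (pr2 C B1 B2) \<cdot>\<^bsub>K\<^esub> h) (embed L A B2 f2)))"


section \<open>The language for states\<close>

definition modifier_category :: "('o, 'm) bicart_data \<Rightarrow> 'o \<Rightarrow> ('o, 'm) cat_data" where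
  "modifier_category C S =
    \<lparr>Obj = Obj C,
     Hom = (\<lambda>A B. Hom C (A \<otimes>\<^bsub>C\<^esub> S) (B \<otimes>\<^bsub>C\<^esub> S)),
     Comp = Comp C,
     Id = (\<lambda>A. Id C (A \<otimes>\<^bsub>C\<^esub> S))\<rparr>"

definition pure_modifier :: "('o, 'm) bicart_data \<Rightarrow> 'o \<Rightarrow> 'o \<Rightarrow> 'o \<Rightarrow> 'm \<Rightarrow> 'm" where
  "pure_modifier C S A B f = prod_map C A S B S f (Id C S)"

definition states_language :: "('o, 'm) bicart_data \<Rightarrow> 'o \<Rightarrow> ('o, 'm, 'm) effect_language" where
  "states_language C S =
    \<lparr>pure = C, general = modifier_category C S, embed = pure_modifier C S\<rparr>"

definition counit :: "('o, 'm) bicart_data \<Rightarrow> 'o \<Rightarrow> 'o \<Rightarrow> 'm" where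
  "counit C S X = pr1 C X S"

definition weak_eq :: "('o, 'm) bicart_data \<Rightarrow> 'o \<Rightarrow> 'o \<Rightarrow> 'o \<Rightarrow> 'm \<Rightarrow> 'm \<Rightarrow> bool" where
  "weak_eq C S A B f g \<longleftrightarrow> counit C S B \<cdot>\<^bsub>C\<^esub> f = counit C S B \<cdot>\<^bsub>C\<^esub> g"

end

theory Submission
  imports Defs
begin

text \<open>
  A copair of modifiers is a morphism out of \<open>(A1 + A2) \<times> S\<close>, and distributivity exhibits that
  object as a coproduct of \<open>A1 \<times> S\<close> and \<open>A2 \<times> S\<close>. A sequential pair is a morphism into
  \<open>(B1 \<times> B2) \<times> S\<close>: the weak equation prescribes its component in one of the \<open>Bi\<close>, while the
  strong one prescribes the component in the other and the resulting state.
\<close>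

section \<open>Universal properties of binary products and coproducts\<close>

context bicartesian_category
begin

text \<open>The projections are jointly monic: both morphisms solve the universal problem posed by
  the components of \<open>k\<close>, and that problem has one solution.\<close>

lemma Prod_eqI:
  assumes "A \<in> Obj C" "B \<in> Obj C" "X \<in> Obj C"
    and "h \<in> Hom C X (A \<otimes> B)" "k \<in> Hom C X (A \<otimes> B)"
    and "pr1 C A B \<cdot> h = pr1 C A B \<cdot> k" "pr2 C A B \<cdot> h = pr2 C A B \<cdot> k"
  shows "h = k"
proof -
  note P = Prod_Obj[OF assms(1,2)]
  show ?thesis
    using Prod_universal[OF assms(1-3)
        Comp_in_Hom[OF assms(3) P assms(1,5) pr1_in_Hom[OF assms(1,2)]]
        Comp_in_Hom[OF assms(3) P assms(2,5) pr2_in_Hom[OF assms(1,2)]]] assms(4-7)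
    by blast
qed

lemma
  assumes "A \<in> Obj C" "B \<in> Obj C" "X \<in> Obj C" "f \<in> Hom C X A" "g \<in> Hom C X B"
  shows pair_in_Hom: "pair C X A B f g \<in> Hom C X (A \<otimes> B)"
    and pr1_pair: "pr1 C A B \<cdot> pair C X A B f g = f"
    and pr2_pair: "pr2 C A B \<cdot> pair C X A B f g = g"
  using theI'[OF Prod_universal[OF assms]] unfolding pair_def by auto

lemma Sum_eqI:
  assumes "A \<in> Obj C" "B \<in> Obj C" "X \<in> Obj C"
    and "h \<in> Hom C (A \<oplus> B) X" "k \<in> Hom C (A \<oplus> B) X"
    and "h \<cdot> copr1 C A B = k \<cdot> copr1 C A B" "h \<cdot> copr2 C A B = k \<cdot> copr2 C A B"
  shows "h = k"
proof -
  note Q = Sum_Obj[OF assms(1,2)]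
  show ?thesis
    using Sum_universal[OF assms(1-3)
        Comp_in_Hom[OF assms(1) Q assms(3) copr1_in_Hom[OF assms(1,2)] assms(5)]
        Comp_in_Hom[OF assms(2) Q assms(3) copr2_in_Hom[OF assms(1,2)] assms(5)]] assms(4-7)
    by blast
qed

lemma
  assumes "A \<in> Obj C" "B \<in> Obj C" "X \<in> Obj C" "f \<in> Hom C A X" "g \<in> Hom C B X"
  shows copair_in_Hom: "copair C A B X f g \<in> Hom C (A \<oplus> B) X"
    and copair_copr1: "copair C A B X f g \<cdot> copr1 C A B = f"
    and copair_copr2: "copair C A B X f g \<cdot> copr2 C A B = g"
  using theI'[OF Sum_universal[OF assms]] unfolding copair_def by auto

section \<open>Functoriality of the binary product\<close>

lemma
  assumes "A \<in> Obj C" "A' \<in> Obj C" "B \<in> Obj C" "B' \<in> Obj C" "f \<in> Hom C A B" "g \<in> Hom C A' B'"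
  shows prod_map_in_Hom: "prod_map C A A' B B' f g \<in> Hom C (A \<otimes> A') (B \<otimes> B')"
    and pr1_prod_map: "pr1 C B B' \<cdot> prod_map C A A' B B' f g = f \<cdot> pr1 C A A'"
    and pr2_prod_map: "pr2 C B B' \<cdot> prod_map C A A' B B' f g = g \<cdot> pr2 C A A'"
proof -
  have o: "A \<otimes> A' \<in> Obj C" using assms Prod_Obj by blast
  note 1 = Comp_in_Hom[OF o assms(1,3) pr1_in_Hom[OF assms(1,2)] assms(5)]
    and 2 = Comp_in_Hom[OF o assms(2,4) pr2_in_Hom[OF assms(1,2)] assms(6)]
  note * = assms(3,4) o 1 2
  show "prod_map C A A' B B' f g \<in> Hom C (A \<otimes> A') (B \<otimes> B')"
    and "pr1 C B B' \<cdot> prod_map C A A' B B' f g = f \<cdot> pr1 C A A'"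
    and "pr2 C B B' \<cdot> prod_map C A A' B B' f g = g \<cdot> pr2 C A A'"
    unfolding prod_map_def using pair_in_Hom[OF *] pr1_pair[OF *] pr2_pair[OF *] by auto
qed

text \<open>Associativity is available only for typed, composable morphisms. Settling it here once
  lets later proofs compute the components of \<open>prod_map\<close> followed through an arbitrary
  \<open>h\<close> by plain rewriting.\<close>

lemma
  assumes "A \<in> Obj C" "A' \<in> Obj C" "B \<in> Obj C" "B' \<in> Obj C" "f \<in> Hom C A B" "g \<in> Hom C A' B'"
    and "X \<in> Obj C" "h \<in> Hom C X (A \<otimes> A')"
  shows pr1_prod_map_Comp:
      "pr1 C B B' \<cdot> (prod_map C A A' B B' f g \<cdot> h) = f \<cdot> (pr1 C A A' \<cdot> h)"
    and pr2_prod_map_Comp: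
      "pr2 C B B' \<cdot> (prod_map C A A' B B' f g \<cdot> h) = g \<cdot> (pr2 C A A' \<cdot> h)"
proof -
  have o: "A \<otimes> A' \<in> Obj C" "B \<otimes> B' \<in> Obj C" using assms Prod_Obj by auto
  note p = prod_map_in_Hom[OF assms(1-6)]
  show "pr1 C B B' \<cdot> (prod_map C A A' B B' f g \<cdot> h) = f \<cdot> (pr1 C A A' \<cdot> h)"
    using Comp_assoc[OF assms(7) o assms(3) assms(8) p pr1_in_Hom]
      Comp_assoc[OF assms(7) o(1) assms(1,3,8) pr1_in_Hom assms(5)]
      pr1_prod_map[OF assms(1-6)] assms by simp
  show "pr2 C B B' \<cdot> (prod_map C A A' B B' f g \<cdot> h) = g \<cdot> (pr2 C A A' \<cdot> h)"
    using Comp_assoc[OF assms(7) o assms(4) assms(8) p pr2_in_Hom]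
      Comp_assoc[OF assms(7) o(1) assms(2,4,8) pr2_in_Hom assms(6)]
      pr2_prod_map[OF assms(1-6)] assms by simp
qed

lemma prod_map_Id:
  assumes "A \<in> Obj C" "B \<in> Obj C"
  shows "prod_map C A B A B (Id C A) (Id C B) = Id C (A \<otimes> B)"
proof -
  note o = Prod_Obj[OF assms] and i = Id_in_Hom[OF assms(1)] Id_in_Hom[OF assms(2)]
  show ?thesis
    using Prod_eqI[OF assms o prod_map_in_Hom[OF assms assms i] Id_in_Hom[OF o]]
      pr1_prod_map[OF assms assms i] pr2_prod_map[OF assms assms i]
      Comp_Id_left[OF o assms(1) pr1_in_Hom] Comp_Id_right[OF o assms(1) pr1_in_Hom]
      Comp_Id_left[OF o assms(2) pr2_in_Hom] Comp_Id_right[OF o assms(2) pr2_in_Hom] assms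
    by simp
qed

text \<open>Both sides have the same two projections. With identities on the second factor this
  becomes the functoriality of \<open>f \<mapsto> f \<times> id\<close>, hence of the embedding of
  pure terms.\<close>

lemma prod_map_Comp:
  assumes "A \<in> Obj C" "A' \<in> Obj C" "B \<in> Obj C" "B' \<in> Obj C" "D \<in> Obj C" "D' \<in> Obj C"
    and "f \<in> Hom C A B" "g \<in> Hom C A' B'" "f' \<in> Hom C B D" "g' \<in> Hom C B' D'"
  shows "prod_map C A A' D D' (f' \<cdot> f) (g' \<cdot> g) =
    prod_map C B B' D D' f' g' \<cdot> prod_map C A A' B B' f g"
proof -
  have o: "A \<otimes> A' \<in> Obj C" "B \<otimes> B' \<in> Obj C" "D \<otimes> D' \<in> Obj C" using assms Prod_Obj by auto
  have c: "f' \<cdot> f \<in> Hom C A D" "g' \<cdot> g \<in> Hom C A' D'"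
    using Comp_in_Hom[of A B D f f'] Comp_in_Hom[of A' B' D' g g'] assms by auto
  note p = prod_map_in_Hom[OF assms(1-4,7,8)] and q = prod_map_in_Hom[OF assms(3-6,9,10)]
  show ?thesis
  proof (rule Prod_eqI[OF assms(5,6) o(1) prod_map_in_Hom[OF assms(1,2,5,6) c] Comp_in_Hom[OF o p q]])
    show "pr1 C D D' \<cdot> prod_map C A A' D D' (f' \<cdot> f) (g' \<cdot> g) =
      pr1 C D D' \<cdot> (prod_map C B B' D D' f' g' \<cdot> prod_map C A A' B B' f g)"
      using pr1_prod_map[OF assms(1,2,5,6) c] pr1_prod_map_Comp[OF assms(3-6,9,10) o(1) p]
        pr1_prod_map[OF assms(1-4,7,8)]
        Comp_assoc[OF o(1) assms(1,3,5) pr1_in_Hom assms(7,9)] assms by simp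
    show "pr2 C D D' \<cdot> prod_map C A A' D D' (f' \<cdot> f) (g' \<cdot> g) =
      pr2 C D D' \<cdot> (prod_map C B B' D D' f' g' \<cdot> prod_map C A A' B B' f g)"
      using pr2_prod_map[OF assms(1,2,5,6) c] pr2_prod_map_Comp[OF assms(3-6,9,10) o(1) p]
        pr2_prod_map[OF assms(1-4,7,8)]
        Comp_assoc[OF o(1) assms(2,4,6) pr2_in_Hom assms(8,10)] assms by simp
  qed
qed

section \<open>Symmetry of the product\<close>

text \<open>The symmetry is needed because \<open>distributor\<close> keeps the common factor on the
  left, whereas modifiers carry the state on the right.\<close>

definition swap :: "'o \<Rightarrow> 'o \<Rightarrow> 'm" where
  "swap A B = pair C (A \<otimes> B) B A (pr2 C A B) (pr1 C A B)"

lemma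
  assumes "A \<in> Obj C" "B \<in> Obj C"
  shows swap_in_Hom: "swap A B \<in> Hom C (A \<otimes> B) (B \<otimes> A)"
    and pr1_swap: "pr1 C B A \<cdot> swap A B = pr2 C A B"
    and pr2_swap: "pr2 C B A \<cdot> swap A B = pr1 C A B"
  unfolding swap_def
  using pair_in_Hom pr1_pair pr2_pair assms Prod_Obj pr1_in_Hom pr2_in_Hom by auto

lemma
  assumes "A \<in> Obj C" "B \<in> Obj C" "X \<in> Obj C" "h \<in> Hom C X (A \<otimes> B)"
  shows pr1_swap_Comp: "pr1 C B A \<cdot> (swap A B \<cdot> h) = pr2 C A B \<cdot> h"
    and pr2_swap_Comp: "pr2 C B A \<cdot> (swap A B \<cdot> h) = pr1 C A B \<cdot> h"
proof -
  note a = assms(1,2) and o = Prod_Obj[OF assms(1,2)] Prod_Obj[OF assms(2,1)]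
  note s = swap_in_Hom[OF a]
  show "pr1 C B A \<cdot> (swap A B \<cdot> h) = pr2 C A B \<cdot> h"
    using Comp_assoc[OF assms(3) o assms(2,4) s pr1_in_Hom] pr1_swap[OF a] a by simp
  show "pr2 C B A \<cdot> (swap A B \<cdot> h) = pr1 C A B \<cdot> h"
    using Comp_assoc[OF assms(3) o assms(1,4) s pr2_in_Hom] pr2_swap[OF a] a by simp
qed

lemma swap_swap:
  assumes "A \<in> Obj C" "B \<in> Obj C"
  shows "swap B A \<cdot> swap A B = Id C (A \<otimes> B)"
proof -
  note o = Prod_Obj[OF assms] Prod_Obj[OF assms(2,1)]
  note s = swap_in_Hom[OF assms] swap_in_Hom[OF assms(2,1)]
  show ?thesis
    using Prod_eqI[OF assms o(1) Comp_in_Hom[OF o(1,2,1) s] Id_in_Hom[OF o(1)]]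
      pr1_swap_Comp[OF assms(2,1) o(1) s(1)] pr2_swap_Comp[OF assms(2,1) o(1) s(1)]
      pr1_swap[OF assms] pr2_swap[OF assms]
      Comp_Id_right[OF o(1) assms(1) pr1_in_Hom] Comp_Id_right[OF o(1) assms(2) pr2_in_Hom] assms
    by simp
qed

text \<open>Naturality of the symmetry, checked on the two projections.\<close>

lemma swap_prod_map:
  assumes "A \<in> Obj C" "A' \<in> Obj C" "B \<in> Obj C" "B' \<in> Obj C" "f \<in> Hom C A B" "g \<in> Hom C A' B'"
  shows "swap B B' \<cdot> prod_map C A A' B B' f g = prod_map C A' A B' B g f \<cdot> swap A A'"
proof -
  note o = Prod_Obj[OF assms(1,2)] Prod_Obj[OF assms(3,4)]
    Prod_Obj[OF assms(2,1)] Prod_Obj[OF assms(4,3)]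
  note p = prod_map_in_Hom[OF assms] and q = prod_map_in_Hom[OF assms(2,1,4,3,6,5)]
    and s = swap_in_Hom[OF assms(1,2)]
  show ?thesis
    using Prod_eqI[OF assms(4,3) o(1) Comp_in_Hom[OF o(1,2,4) p swap_in_Hom[OF assms(3,4)]]
          Comp_in_Hom[OF o(1,3,4) s q]]
      pr1_swap_Comp[OF assms(3,4) o(1) p] pr2_swap_Comp[OF assms(3,4) o(1) p]
      pr1_prod_map_Comp[OF assms(2,1,4,3,6,5) o(1) s]
      pr2_prod_map_Comp[OF assms(2,1,4,3,6,5) o(1) s]
      pr1_prod_map[OF assms] pr2_prod_map[OF assms]
      pr1_swap[OF assms(1,2)] pr2_swap[OF assms(1,2)]
    by simp
qed

section \<open>Sequential pairs as morphisms into a ternary product\<close>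

text \<open>A morphism into \<open>(B1 \<otimes> B2) \<otimes> S\<close> amounts to three
  components. Here \<open>a\<close> supplies the one in \<open>B1\<close>, and \<open>f\<close>
  those in \<open>B2\<close> and \<open>S\<close>. For modifiers out of \<open>A\<close>, the object
  \<open>X\<close> will be \<open>A \<otimes> S\<close>.\<close>

lemma sequential_pair_left:
  assumes "X \<in> Obj C" "B1 \<in> Obj C" "B2 \<in> Obj C" "S \<in> Obj C"
    and "a \<in> Hom C X B1" "f \<in> Hom C X (B2 \<otimes> S)"
  shows "\<exists>!h. h \<in> Hom C X ((B1 \<otimes> B2) \<otimes> S) \<and>
    pr1 C B1 S \<cdot> (prod_map C (B1 \<otimes> B2) S B1 S (pr1 C B1 B2) (Id C S) \<cdot> h) = a \<and>
    prod_map C (B1 \<otimes> B2) S B2 S (pr2 C B1 B2) (Id C S) \<cdot> h = f"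
proof -
  note B = Prod_Obj[OF assms(2,3)]
  note BS = Prod_Obj[OF B assms(4)] and B2S = Prod_Obj[OF assms(3,4)]
  note p1 = pr1_in_Hom[OF assms(2,3)] and p2 = pr2_in_Hom[OF assms(2,3)]
    and i = Id_in_Hom[OF assms(4)]
  \<comment> \<open>\<open>f\<close> is split into its result \<open>b\<close> and its final state
    \<open>s\<close>.\<close>
  define b where "b = pr1 C B2 S \<cdot> f"
  define s where "s = pr2 C B2 S \<cdot> f"
  have b: "b \<in> Hom C X B2" and s: "s \<in> Hom C X S"
    unfolding b_def s_def
    using Comp_in_Hom[OF assms(1) B2S assms(3) assms(6) pr1_in_Hom[OF assms(3,4)]]
      Comp_in_Hom[OF assms(1) B2S assms(4) assms(6) pr2_in_Hom[OF assms(3,4)]]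
    by auto
  \<comment> \<open>For well-typed \<open>h\<close> the two equations just fix its projections to
    \<open>B1 \<otimes> B2\<close> and to \<open>S\<close>, so the claim reduces to the universal
    property of the outer product.\<close>
  have char: "pr1 C B1 S \<cdot> (prod_map C (B1 \<otimes> B2) S B1 S (pr1 C B1 B2) (Id C S) \<cdot> h) = a \<and>
      prod_map C (B1 \<otimes> B2) S B2 S (pr2 C B1 B2) (Id C S) \<cdot> h = f \<longleftrightarrow>
      pr1 C (B1 \<otimes> B2) S \<cdot> h = pair C X B1 B2 a b \<and> pr2 C (B1 \<otimes> B2) S \<cdot> h = s"
    if h: "h \<in> Hom C X ((B1 \<otimes> B2) \<otimes> S)" for h
  proof -
    note ab = pair_in_Hom[OF assms(2,3,1,5) b]
    have k: "pr1 C (B1 \<otimes> B2) S \<cdot> h \<in> Hom C X (B1 \<otimes> B2)"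
      and t: "pr2 C (B1 \<otimes> B2) S \<cdot> h \<in> Hom C X S"
      using Comp_in_Hom[OF assms(1) BS B h pr1_in_Hom[OF B assms(4)]]
        Comp_in_Hom[OF assms(1) BS assms(4) h pr2_in_Hom[OF B assms(4)]]
      by auto
    note q = prod_map_in_Hom[OF B assms(4,3,4) p2 i]
    \<comment> \<open>The strong equation is tested on both projections; the identity on
      \<open>S\<close> makes the state of \<open>h\<close> itself appear.\<close>
    have "prod_map C (B1 \<otimes> B2) S B2 S (pr2 C B1 B2) (Id C S) \<cdot> h = f \<longleftrightarrow>
        pr2 C B1 B2 \<cdot> (pr1 C (B1 \<otimes> B2) S \<cdot> h) = b \<and> pr2 C (B1 \<otimes> B2) S \<cdot> h = s"
      using Prod_eqI[OF assms(3,4,1) Comp_in_Hom[OF assms(1) BS B2S h q] assms(6)]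
        pr1_prod_map_Comp[OF B assms(4,3,4) p2 i assms(1) h]
        pr2_prod_map_Comp[OF B assms(4,3,4) p2 i assms(1) h]
        Comp_Id_left[OF assms(1,4) t]
      unfolding b_def s_def by auto
    moreover have "pr1 C (B1 \<otimes> B2) S \<cdot> h = pair C X B1 B2 a b \<longleftrightarrow>
        pr1 C B1 B2 \<cdot> (pr1 C (B1 \<otimes> B2) S \<cdot> h) = a \<and> pr2 C B1 B2 \<cdot> (pr1 C (B1 \<otimes> B2) S \<cdot> h) = b"
      using Prod_eqI[OF assms(2,3,1) k ab] pr1_pair[OF assms(2,3,1,5) b]
        pr2_pair[OF assms(2,3,1,5) b] by auto
    ultimately show ?thesis
      using pr1_prod_map_Comp[OF B assms(4,2,4) p1 i assms(1) h] by auto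
  qed
  \<comment> \<open>\<open>char\<close> presupposes the type of \<open>h\<close>;
    \<open>conj_cong\<close> makes the typing conjunct available while the equations are
    rewritten.\<close>
  show ?thesis
    using Prod_universal[OF B assms(4,1) pair_in_Hom[OF assms(2,3,1,5) b] s]
    by (simp add: char cong: conj_cong)
qed

text \<open>The mirror image of the left pair: \<open>f\<close> now supplies the component in
  \<open>B1\<close> together with the state, and \<open>a\<close> the one in
  \<open>B2\<close>.\<close>

lemma sequential_pair_right:
  assumes "X \<in> Obj C" "B1 \<in> Obj C" "B2 \<in> Obj C" "S \<in> Obj C"
    and "f \<in> Hom C X (B1 \<otimes> S)" "a \<in> Hom C X B2"
  shows "\<exists>!h. h \<in> Hom C X ((B1 \<otimes> B2) \<otimes> S) \<and>
    prod_map C (B1 \<otimes> B2) S B1 S (pr1 C B1 B2) (Id C S) \<cdot> h = f \<and>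
    pr1 C B2 S \<cdot> (prod_map C (B1 \<otimes> B2) S B2 S (pr2 C B1 B2) (Id C S) \<cdot> h) = a"
proof -
  note B = Prod_Obj[OF assms(2,3)]
  note BS = Prod_Obj[OF B assms(4)] and B1S = Prod_Obj[OF assms(2,4)]
  note p1 = pr1_in_Hom[OF assms(2,3)] and p2 = pr2_in_Hom[OF assms(2,3)]
    and i = Id_in_Hom[OF assms(4)]
  define b where "b = pr1 C B1 S \<cdot> f"
  define s where "s = pr2 C B1 S \<cdot> f"
  have b: "b \<in> Hom C X B1" and s: "s \<in> Hom C X S"
    unfolding b_def s_def
    using Comp_in_Hom[OF assms(1) B1S assms(2) assms(5) pr1_in_Hom[OF assms(2,4)]]
      Comp_in_Hom[OF assms(1) B1S assms(4) assms(5) pr2_in_Hom[OF assms(2,4)]]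
    by auto
  have char: "prod_map C (B1 \<otimes> B2) S B1 S (pr1 C B1 B2) (Id C S) \<cdot> h = f \<and>
      pr1 C B2 S \<cdot> (prod_map C (B1 \<otimes> B2) S B2 S (pr2 C B1 B2) (Id C S) \<cdot> h) = a \<longleftrightarrow>
      pr1 C (B1 \<otimes> B2) S \<cdot> h = pair C X B1 B2 b a \<and> pr2 C (B1 \<otimes> B2) S \<cdot> h = s"
    if h: "h \<in> Hom C X ((B1 \<otimes> B2) \<otimes> S)" for h
  proof -
    note ba = pair_in_Hom[OF assms(2,3,1) b assms(6)]
    have k: "pr1 C (B1 \<otimes> B2) S \<cdot> h \<in> Hom C X (B1 \<otimes> B2)"
      and t: "pr2 C (B1 \<otimes> B2) S \<cdot> h \<in> Hom C X S"
      using Comp_in_Hom[OF assms(1) BS B h pr1_in_Hom[OF B assms(4)]]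
        Comp_in_Hom[OF assms(1) BS assms(4) h pr2_in_Hom[OF B assms(4)]]
      by auto
    note q = prod_map_in_Hom[OF B assms(4,2,4) p1 i]
    have "prod_map C (B1 \<otimes> B2) S B1 S (pr1 C B1 B2) (Id C S) \<cdot> h = f \<longleftrightarrow>
        pr1 C B1 B2 \<cdot> (pr1 C (B1 \<otimes> B2) S \<cdot> h) = b \<and> pr2 C (B1 \<otimes> B2) S \<cdot> h = s"
      using Prod_eqI[OF assms(2,4,1) Comp_in_Hom[OF assms(1) BS B1S h q] assms(5)]
        pr1_prod_map_Comp[OF B assms(4,2,4) p1 i assms(1) h]
        pr2_prod_map_Comp[OF B assms(4,2,4) p1 i assms(1) h]
        Comp_Id_left[OF assms(1,4) t]
      unfolding b_def s_def by auto
    moreover have "pr1 C (B1 \<otimes> B2) S \<cdot> h = pair C X B1 B2 b a \<longleftrightarrow>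
        pr1 C B1 B2 \<cdot> (pr1 C (B1 \<otimes> B2) S \<cdot> h) = b \<and> pr2 C B1 B2 \<cdot> (pr1 C (B1 \<otimes> B2) S \<cdot> h) = a"
      using Prod_eqI[OF assms(2,3,1) k ba] pr1_pair[OF assms(2,3,1) b assms(6)]
        pr2_pair[OF assms(2,3,1) b assms(6)] by auto
    ultimately show ?thesis
      using pr1_prod_map_Comp[OF B assms(4,3,4) p2 i assms(1) h] by auto
  qed
  show ?thesis
    using Prod_universal[OF B assms(4,1) pair_in_Hom[OF assms(2,3,1) b assms(6)] s]
    by (simp add: char cong: conj_cong)
qed

end

section \<open>Copairs from distributivity\<close>

context distributive_category
begin

text \<open>The distributor is an isomorphism that carries the coprojections of
  \<open>(S \<otimes> A1) \<oplus> (S \<otimes> A2)\<close> to the maps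
  \<open>id \<times> copr\<close>, so these maps inherit the universal property of a
  coproduct.\<close>

lemma Prod_Sum_universal:
  assumes "S \<in> Obj C" "A1 \<in> Obj C" "A2 \<in> Obj C" "X \<in> Obj C"
    and "f1 \<in> Hom C (S \<otimes> A1) X" "f2 \<in> Hom C (S \<otimes> A2) X"
  shows "\<exists>!h. h \<in> Hom C (S \<otimes> (A1 \<oplus> A2)) X \<and>
    h \<cdot> prod_map C S A1 S (A1 \<oplus> A2) (Id C S) (copr1 C A1 A2) = f1 \<and>
    h \<cdot> prod_map C S A2 S (A1 \<oplus> A2) (Id C S) (copr2 C A1 A2) = f2"
    (is "\<exists>!h. h \<in> Hom C ?P X \<and> h \<cdot> ?i1 = f1 \<and> h \<cdot> ?i2 = f2")
proof -
  note A = Sum_Obj[OF assms(2,3)]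
  note P = Prod_Obj[OF assms(1) A] and P1 = Prod_Obj[OF assms(1,2)] and P2 = Prod_Obj[OF assms(1,3)]
  note Q = Sum_Obj[OF P1 P2]
  have i: "?i1 \<in> Hom C (S \<otimes> A1) ?P" "?i2 \<in> Hom C (S \<otimes> A2) ?P"
    using prod_map_in_Hom[OF assms(1,2,1) A Id_in_Hom[OF assms(1)] copr1_in_Hom[OF assms(2,3)]]
      prod_map_in_Hom[OF assms(1,3,1) A Id_in_Hom[OF assms(1)] copr2_in_Hom[OF assms(2,3)]]
    by auto
  note j = copr1_in_Hom[OF P1 P2] copr2_in_Hom[OF P1 P2]
  let ?Q = "(S \<otimes> A1) \<oplus> (S \<otimes> A2)"
  let ?d = "distributor C S A1 A2"
  obtain e where d: "?d \<in> Hom C ?Q ?P" and e: "e \<in> Hom C ?P ?Q"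
    and ed: "e \<cdot> ?d = Id C ?Q" and de: "?d \<cdot> e = Id C ?P"
    using distributive[OF assms(1-3)] unfolding is_iso_def by blast
  have dc: "?d \<cdot> copr1 C (S \<otimes> A1) (S \<otimes> A2) = ?i1" "?d \<cdot> copr2 C (S \<otimes> A1) (S \<otimes> A2) = ?i2"
    unfolding distributor_def using copair_copr1[OF P1 P2 P i] copair_copr2[OF P1 P2 P i] by auto
  let ?c = "copair C (S \<otimes> A1) (S \<otimes> A2) X f1 f2"
  note c = copair_in_Hom[OF P1 P2 assms(4-6)]
  \<comment> \<open>Precomposing with \<open>?d\<close> turns the two equations into those defining
    the copair \<open>?c\<close>; the inverse \<open>e\<close> then solves
    \<open>h \<cdot> ?d = ?c\<close> for \<open>h\<close>.\<close>
  have char: "h \<cdot> ?i1 = f1 \<and> h \<cdot> ?i2 = f2 \<longleftrightarrow> h = ?c \<cdot> e" if h: "h \<in> Hom C ?P X" for h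
  proof -
    have hd: "(h \<cdot> ?d) \<cdot> copr1 C (S \<otimes> A1) (S \<otimes> A2) = h \<cdot> ?i1"
      "(h \<cdot> ?d) \<cdot> copr2 C (S \<otimes> A1) (S \<otimes> A2) = h \<cdot> ?i2"
      using Comp_assoc[OF P1 Q P assms(4) j(1) d h] Comp_assoc[OF P2 Q P assms(4) j(2) d h]
      by (simp_all only: dc)
    note cc = copair_copr1[OF P1 P2 assms(4-6)] copair_copr2[OF P1 P2 assms(4-6)]
    have "h \<cdot> ?i1 = f1 \<and> h \<cdot> ?i2 = f2 \<longleftrightarrow> h \<cdot> ?d = ?c"
    proof
      assume "h \<cdot> ?i1 = f1 \<and> h \<cdot> ?i2 = f2"
      then show "h \<cdot> ?d = ?c"
        using Sum_eqI[OF P1 P2 assms(4) Comp_in_Hom[OF Q P assms(4) d h] c] hd cc by simp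
    next
      assume "h \<cdot> ?d = ?c"
      then show "h \<cdot> ?i1 = f1 \<and> h \<cdot> ?i2 = f2"
        using hd cc by simp
    qed
    also have "\<dots> \<longleftrightarrow> h = ?c \<cdot> e"
    proof
      assume "h \<cdot> ?d = ?c"
      then show "h = ?c \<cdot> e"
        using Comp_assoc[OF P Q P assms(4) e d h] Comp_Id_right[OF P assms(4) h] by (simp only: de)
    next
      assume "h = ?c \<cdot> e"
      then show "h \<cdot> ?d = ?c"
        using Comp_assoc[OF Q P Q assms(4) d e c] Comp_Id_right[OF Q assms(4) c] by (simp only: ed)
    qed
    finally show ?thesis .
  qed
  note ce = Comp_in_Hom[OF P Q assms(4) e c]
  \<comment> \<open>Since the equations say that \<open>h\<close> equals one fixed, well-typed
    morphism, existence and uniqueness follow together.\<close>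
  show ?thesis
    using ce by (auto simp: char cong: conj_cong)
qed

text \<open>The previous universal property is transported along the symmetry, which moves the
  factor \<open>S\<close> to the right.\<close>

lemma Sum_Prod_universal:
  assumes "S \<in> Obj C" "A1 \<in> Obj C" "A2 \<in> Obj C" "X \<in> Obj C"
    and "f1 \<in> Hom C (A1 \<otimes> S) X" "f2 \<in> Hom C (A2 \<otimes> S) X"
  shows "\<exists>!h. h \<in> Hom C ((A1 \<oplus> A2) \<otimes> S) X \<and>
    h \<cdot> prod_map C A1 S (A1 \<oplus> A2) S (copr1 C A1 A2) (Id C S) = f1 \<and>
    h \<cdot> prod_map C A2 S (A1 \<oplus> A2) S (copr2 C A1 A2) (Id C S) = f2"
proof -
  note A = Sum_Obj[OF assms(2,3)] and i = Id_in_Hom[OF assms(1)]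
  note P = Prod_Obj[OF A assms(1)] and P' = Prod_Obj[OF assms(1) A]
  \<comment> \<open>Naturality slides the swap past \<open>c \<times> id\<close>. The equivalence
    holds in both directions because the swap is invertible and can be cancelled. It will be used
    with \<open>c\<close> a coprojection.\<close>
  have precomp: "h \<cdot> prod_map C B S (A1 \<oplus> A2) S c (Id C S) = f \<longleftrightarrow>
      (h \<cdot> swap S (A1 \<oplus> A2)) \<cdot> prod_map C S B S (A1 \<oplus> A2) (Id C S) c = f \<cdot> swap S B"
    if B: "B \<in> Obj C" and c: "c \<in> Hom C B (A1 \<oplus> A2)" and f: "f \<in> Hom C (B \<otimes> S) X"
      and h: "h \<in> Hom C ((A1 \<oplus> A2) \<otimes> S) X" for B c f h
  proof -
    note BS = Prod_Obj[OF B assms(1)] and SB = Prod_Obj[OF assms(1) B]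
    note p = prod_map_in_Hom[OF B assms(1) A assms(1) c i]
      and q = prod_map_in_Hom[OF assms(1) B assms(1) A i c]
    note s = swap_in_Hom[OF assms(1) A] and t = swap_in_Hom[OF assms(1) B]
      and t' = swap_in_Hom[OF B assms(1)]
    note hp = Comp_in_Hom[OF BS P assms(4) p h]
    have "(h \<cdot> swap S (A1 \<oplus> A2)) \<cdot> prod_map C S B S (A1 \<oplus> A2) (Id C S) c =
        (h \<cdot> prod_map C B S (A1 \<oplus> A2) S c (Id C S)) \<cdot> swap S B"
      using Comp_assoc[OF SB P' P assms(4) q s h] Comp_assoc[OF SB BS P assms(4) t p h]
        swap_prod_map[OF assms(1) B assms(1) A i c] by simp
    moreover have "(u \<cdot> swap S B) \<cdot> swap B S = u" if "u \<in> Hom C (B \<otimes> S) X" for u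
      using Comp_assoc[OF BS SB BS assms(4) t' t that] Comp_Id_right[OF BS assms(4) that]
        swap_swap[OF B assms(1)] by simp
    note this[OF hp] this[OF f]
    ultimately show ?thesis by metis
  qed
  note c = copr1_in_Hom[OF assms(2,3)] copr2_in_Hom[OF assms(2,3)]
  note s = swap_in_Hom[OF assms(1) A] and s' = swap_in_Hom[OF A assms(1)]
  have g: "f1 \<cdot> swap S A1 \<in> Hom C (S \<otimes> A1) X" "f2 \<cdot> swap S A2 \<in> Hom C (S \<otimes> A2) X"
    using Comp_in_Hom[OF Prod_Obj[OF assms(1,2)] Prod_Obj[OF assms(2,1)] assms(4)
        swap_in_Hom[OF assms(1,2)] assms(5)]
      Comp_in_Hom[OF Prod_Obj[OF assms(1,3)] Prod_Obj[OF assms(3,1)] assms(4)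
        swap_in_Hom[OF assms(1,3)] assms(6)] by auto
  note ex1 = Prod_Sum_universal[OF assms(1-4) g]
  note char = precomp[OF assms(2) c(1) assms(5)] precomp[OF assms(3) c(2) assms(6)]
  obtain k where k: "k \<in> Hom C (S \<otimes> (A1 \<oplus> A2)) X"
    "k \<cdot> prod_map C S A1 S (A1 \<oplus> A2) (Id C S) (copr1 C A1 A2) = f1 \<cdot> swap S A1"
    "k \<cdot> prod_map C S A2 S (A1 \<oplus> A2) (Id C S) (copr2 C A1 A2) = f2 \<cdot> swap S A2"
    using ex1 by blast
  \<comment> \<open>The witness is the solution \<open>k\<close> of the problem with
    \<open>S\<close> on the left, precomposed with the swap.\<close>
  have k': "k \<cdot> swap (A1 \<oplus> A2) S \<in> Hom C ((A1 \<oplus> A2) \<otimes> S) X"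
    using Comp_in_Hom[OF P P' assms(4) s' k(1)] .
  have "(k \<cdot> swap (A1 \<oplus> A2) S) \<cdot> swap S (A1 \<oplus> A2) = k"
    using Comp_assoc[OF P' P P' assms(4) s s' k(1)] swap_swap[OF assms(1) A]
      Comp_Id_right[OF P' assms(4) k(1)] by simp
  then have sol: "(k \<cdot> swap (A1 \<oplus> A2) S) \<cdot> prod_map C A1 S (A1 \<oplus> A2) S (copr1 C A1 A2) (Id C S) = f1"
    "(k \<cdot> swap (A1 \<oplus> A2) S) \<cdot> prod_map C A2 S (A1 \<oplus> A2) S (copr2 C A1 A2) (Id C S) = f2"
    using char[OF k'] k by auto
  show ?thesis
  proof (rule ex1I[of _ "k \<cdot> swap (A1 \<oplus> A2) S"])
    fix h
    assume h: "h \<in> Hom C ((A1 \<oplus> A2) \<otimes> S) X \<and>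
      h \<cdot> prod_map C A1 S (A1 \<oplus> A2) S (copr1 C A1 A2) (Id C S) = f1 \<and>
      h \<cdot> prod_map C A2 S (A1 \<oplus> A2) S (copr2 C A1 A2) (Id C S) = f2"
    then have hH: "h \<in> Hom C ((A1 \<oplus> A2) \<otimes> S) X" by blast
    \<comment> \<open>By \<open>char\<close>, the swapped \<open>h\<close> solves the problem with
      \<open>S\<close> on the left, where the solution is unique.\<close>
    have "h \<cdot> swap S (A1 \<oplus> A2) = k"
      using ex1 k char[OF hH] h Comp_in_Hom[OF P' P assms(4) s hH] by blast
    then show "h = k \<cdot> swap (A1 \<oplus> A2) S"
      using Comp_assoc[OF P P' P assms(4) s' s hH] swap_swap[OF A assms(1)]
        Comp_Id_right[OF P assms(4) hH] by simp
  qed (use k' sol in blast)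
qed

end

section \<open>The language for states\<close>

text \<open>The category laws for modifiers are those of \<open>C\<close> at objects of the form
  \<open>A \<otimes> S\<close>, and the embedding laws express that
  \<open>f \<mapsto> f \<times> id\<close> is a functor.\<close>

lemma states_language_with_effects:
  assumes "bicartesian_category C" and S: "S \<in> Obj C"
  shows "language_with_effects (states_language C S)"
proof -
  interpret bicartesian_category C by fact
  note P = Prod_Obj[OF _ S]
  have general: "category (modifier_category C S)"
  proof (unfold_locales, goal_cases)
    case (1 A)
    then show ?case using Id_in_Hom[OF P, of A] by (simp add: modifier_category_def)
  next
    case (2 A B D f g)
    then show ?case using Comp_in_Hom[OF P P P, of A B D f g] by (simp add: modifier_category_def)
  next
    case (3 A B D E f g h)
    then show ?case
      using Comp_assoc[OF P P P P, of A B D E f g h] by (simp add: modifier_category_def)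
  next
    case (4 A B f)
    then show ?case using Comp_Id_right[OF P P, of A B f] by (simp add: modifier_category_def)
  next
    case (5 A B f)
    then show ?case using Comp_Id_left[OF P P, of A B f] by (simp add: modifier_category_def)
  qed
  note i = Id_in_Hom[OF S]
  show ?thesis
  proof (rule language_with_effects.intro, goal_cases)
    case 1
    then show ?case using bicartesian_category_axioms by (simp add: states_language_def)
  next
    case 2
    then show ?case using general by (simp add: states_language_def)
  next
    case 3
    then show ?case by (simp add: states_language_def modifier_category_def)
  next
    case (4 A B f)
    then show ?case
      using prod_map_in_Hom[OF _ S _ S _ i, of A B f]
      by (simp add: states_language_def modifier_category_def pure_modifier_def)
  next
    case (5 A)
    then show ?case
      using prod_map_Id[OF _ S, of A]
      by (simp add: states_language_def modifier_category_def pure_modifier_def)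
  next
    case (6 A B D f g)
    \<comment> \<open>\<open>prod_map_Comp\<close> yields \<open>Id C S \<cdot> Id C S\<close> in
      the state component, which has to collapse to \<open>Id C S\<close>.\<close>
    then show ?case
      using prod_map_Comp[OF _ S _ S _ S _ i _ i, of A B D f g] Comp_Id_left[OF S S i]
      by (simp add: states_language_def modifier_category_def pure_modifier_def)
  qed
qed

theorem theorem4p1:
  fixes C :: "('o, 'm) bicart_data" (structure) and S :: 'o
  assumes "distributive_category C"
    and "S \<in> Obj C"
  shows
    "compatible_with_conditionals (states_language C S) \<and>
    compatible_with_sequential_pairs (states_language C S) (weak_eq C S) \<and>
    (\<forall>A1 \<in> Obj C. \<forall>A2 \<in> Obj C. \<forall>B \<in> Obj C.
      \<forall>f1 \<in> Hom C (A1 \<otimes> S) (B \<otimes> S). \<forall>f2 \<in> Hom C (A2 \<otimes> S) (B \<otimes> S).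
        \<exists>!h. h \<in> Hom C ((A1 \<oplus> A2) \<otimes> S) (B \<otimes> S) \<and>
          h \<cdot> prod_map C A1 S (A1 \<oplus> A2) S (copr1 C A1 A2) (Id C S) = f1 \<and>
          h \<cdot> prod_map C A2 S (A1 \<oplus> A2) S (copr2 C A1 A2) (Id C S) = f2) \<and>
    (\<forall>A \<in> Obj C. \<forall>B1 \<in> Obj C. \<forall>B2 \<in> Obj C.
      \<forall>f1 \<in> Hom C A B1. \<forall>f2 \<in> Hom C (A \<otimes> S) (B2 \<otimes> S).
        \<exists>!h. h \<in> Hom C (A \<otimes> S) ((B1 \<otimes> B2) \<otimes> S) \<and>
          weak_eq C S A B1 (pure_modifier C S (B1 \<otimes> B2) B1 (pr1 C B1 B2) \<cdot> h)
            (pure_modifier C S A B1 f1) \<and>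
          pure_modifier C S (B1 \<otimes> B2) B2 (pr2 C B1 B2) \<cdot> h = f2) \<and>
    (\<forall>A \<in> Obj C. \<forall>B1 \<in> Obj C. \<forall>B2 \<in> Obj C.
      \<forall>f1 \<in> Hom C (A \<otimes> S) (B1 \<otimes> S). \<forall>f2 \<in> Hom C A B2.
        \<exists>!h. h \<in> Hom C (A \<otimes> S) ((B1 \<otimes> B2) \<otimes> S) \<and>
          pure_modifier C S (B1 \<otimes> B2) B1 (pr1 C B1 B2) \<cdot> h = f1 \<and>
          weak_eq C S A B2 (pure_modifier C S (B1 \<otimes> B2) B2 (pr2 C B1 B2) \<cdot> h)
            (pure_modifier C S A B2 f2))"
proof -
  let "_ \<and> _ \<and> ?conditionals \<and> ?left \<and> ?right" = ?thesis
  interpret distributive_category C by fact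
  note S = \<open>S \<in> Obj C\<close>
  note lang = states_language_with_effects[OF bicartesian_category_axioms S]
  note i = Id_in_Hom[OF S]
  have cond: ?conditionals
    using Sum_Prod_universal[OF S] Prod_Obj[OF _ S] by blast
  \<comment> \<open>The counit discards the final state, so a weak equation with a pure term
    constrains only the result.\<close>
  have weak: "weak_eq C S A B h (pure_modifier C S A B f) \<longleftrightarrow> pr1 C B S \<cdot> h = f \<cdot> pr1 C A S"
    if "A \<in> Obj C" "B \<in> Obj C" "f \<in> Hom C A B" for A B f h
    using pr1_prod_map[OF that(1) S that(2) S that(3) i]
    by (simp add: weak_eq_def counit_def pure_modifier_def)
  have fst_Comp: "f \<cdot> pr1 C A S \<in> Hom C (A \<otimes> S) B"
    if "A \<in> Obj C" "B \<in> Obj C" "f \<in> Hom C A B" for A B f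
    using Comp_in_Hom[OF Prod_Obj[OF that(1) S] that(1,2) pr1_in_Hom[OF that(1) S] that(3)] .
  \<comment> \<open>The ternary product argument applies with \<open>X\<close> as
    \<open>A \<otimes> S\<close> and \<open>a\<close> as \<open>f1 \<cdot> pr1 C A S\<close>.
    \<open>weak\<close> must be applied before \<open>pure_modifier\<close> is unfolded, hence the
    two rounds of simplification.\<close>
  have left: ?left
    using sequential_pair_left[OF Prod_Obj[OF _ S] _ _ S fst_Comp]
    by (simp add: weak) (simp add: pure_modifier_def)
  have right: ?right
    using sequential_pair_right[OF Prod_Obj[OF _ S] _ _ S _ fst_Comp]
    by (simp add: weak) (simp add: pure_modifier_def)
  \<comment> \<open>\<open>pure_modifier\<close> involves \<open>f\<close> only through
    \<open>f \<cdot> pr1 C A S\<close>, which is exactly what the weak equation compares. The pure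
    modifiers therefore agree, even where \<open>f\<close> and \<open>g\<close> differ as morphisms
    of \<open>C\<close>.\<close>
  have pure: "weak_eq C S A B (pure_modifier C S A B f) (pure_modifier C S A B g) \<longleftrightarrow>
      pure_modifier C S A B f = pure_modifier C S A B g"
    if "A \<in> Obj C" "B \<in> Obj C" "f \<in> Hom C A B" "g \<in> Hom C A B" for A B f g
  proof
    assume "weak_eq C S A B (pure_modifier C S A B f) (pure_modifier C S A B g)"
    then have "f \<cdot> pr1 C A S = g \<cdot> pr1 C A S"
      using weak[OF that(1,2,4)] pr1_prod_map[OF that(1) S that(2) S that(3) i]
      by (simp add: pure_modifier_def)
    then show "pure_modifier C S A B f = pure_modifier C S A B g"
      by (simp add: pure_modifier_def prod_map_def)
  qed (simp add: weak_eq_def)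
  \<comment> \<open>For \<open>states_language C S\<close> the two compatibility notions unfold to
    the explicit clauses together with \<open>lang\<close> and \<open>pure\<close>.\<close>
  show ?thesis
    using lang cond left right pure
    by (simp add: compatible_with_conditionals_def compatible_with_sequential_pairs_def
        states_language_def modifier_category_def pure_modifier_def)
qed

end
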